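(* Let $k\ge 0$ be an integer, $m=2k+2$ and $n=2$, and let $A=(a_{i_1\cdots i_m})$ be a regular $2$-dimensional $m$th order complex hypermatrix. With $b_j,c_j,d_j$ as defined in the context, put $$\bar b_{2j+1}=b_{2j+1}-\binom{k}{j}\lambda,\qquad \bar c_{2j+2}=c_{2j+2}-\binom{k}{j}\lambda,\qquad j=0,\dots,k.$$ Let $M_1$ be the $(2m-2)\times(2m-2)$ matrix whose rows are as follows (all entries not mentioned are $0$): (i) for $r=1,\dots,m-1$, row $r$ has the $m$ entries $\bar b_1,b_2,\bar b_3,b_4,\dots,\bar b_{m-1},b_m$ in columns $r,r+1,\dots,r+m-1$; (ii) row $m$ has the $m$ entries $c_1,\bar c_2,c_3,\bar c_4,\dots,c_{m-1},\bar c_m$ in columns $m-1,m,\dots,2m-2$; (iii) for $r=1,\dots,m-2$, row $m+r$ has the $m+1$ entries $-c_1,d_1,d_2,\dots,d_{m-1},b_m$ in columns $r,r+1,\dots,r+m$. Then the E-characteristic polynomial of $A$ is $\psi_A(\lambda)=\det(M_1)$.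
   Context: For $x=(x_1,x_2)^T$, $Ax^{m-1}$ is the vector with components $(Ax^{m-1})_i=\sum_{i_2,\dots,i_m=1}^2 a_{ii_2\cdots i_m}x_{i_2}\cdots x_{i_m}$, and $x^Tx=x_1^2+x_2^2$. $A$ is called irregular if there is $x\in\mathbb{C}^2\setminus\{0\}$ with $Ax^{m-1}=0$ and $x^Tx=0$; otherwise $A$ is regular. For $j=1,\dots,m$: $b_j$ is the sum of all $a_{1i_2\cdots i_m}$ such that exactly $j-1$ of $i_2,\dots,i_m$ equal $2$, and $c_j$ is the sum of all $a_{2i_2\cdots i_m}$ such that exactly $j-1$ of $i_2,\dots,i_m$ equal $2$. For $j=1,\dots,m-1$, $d_j=b_j-c_{j+1}$, and $d_m=b_m$. For $m$ even, the E-characteristic polynomial is $\psi_A(\lambda)=\mathrm{Res}_x\big(Ax^{m-1}-\lambda(x^Tx)^{(m-2)/2}x\big)$, the resultant of the two components, which are forms of degree $m-1$ in $x_1,x_2$; $\mathrm{Res}$ is the classical resultant normalized by $\mathrm{Res}(x_1^{d_1},x_2^{d_2})=1$. *)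

theory Defs
  imports Complex_Main "Subresultants.Resultant_Prelim"
    "HOL-Computational_Algebra.Fundamental_Theorem_Algebra"
    "HOL-Computational_Algebra.Field_as_Ring"
    "HOL-Computational_Algebra.Polynomial_Factorial"
begin

text \<open>
  An \<open>m\<close>th order 2-dimensional hypermatrix is a function on index lists \<open>[i\<^sub>1, \<dots>, i\<^sub>m]\<close> with
  entries in \<open>{1, 2}\<close>, and a vector in two coordinates is a function on \<open>{1, 2}\<close>. Values
  at other lists or indices are never used.
\<close>

definition multi_indices :: "nat \<Rightarrow> nat list set" where
  "multi_indices p = {is. set is \<subseteq> {1, 2} \<and> length is = p}"

definition hm_apply ::
    "nat \<Rightarrow> (nat list \<Rightarrow> 'a :: comm_semiring_1) \<Rightarrow> (nat \<Rightarrow> 'a) \<Rightarrow> nat \<Rightarrow> 'a" where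
  "hm_apply m A x i = (\<Sum>is\<in>multi_indices (m - 1). A (i # is) * prod_list (map x is))"

text \<open>
  The product \<open>x\<^sup>T x\<close>, without complex conjugation.
\<close>

definition sq_sum :: "(nat \<Rightarrow> 'a :: comm_semiring_1) \<Rightarrow> 'a" where
  "sq_sum x = x 1 ^ 2 + x 2 ^ 2"

definition irregular :: "nat \<Rightarrow> (nat list \<Rightarrow> complex) \<Rightarrow> bool" where
  "irregular m A \<longleftrightarrow>
    (\<exists>x. (x 1 \<noteq> 0 \<or> x 2 \<noteq> 0) \<and> (\<forall>i\<in>{1, 2}. hm_apply m A x i = 0) \<and> sq_sum x = 0)"

abbreviation regular :: "nat \<Rightarrow> (nat list \<Rightarrow> complex) \<Rightarrow> bool" where
  "regular m A \<equiv> \<not> irregular m A"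

definition b_coef :: "nat \<Rightarrow> (nat list \<Rightarrow> complex) \<Rightarrow> nat \<Rightarrow> complex" where
  "b_coef m A j = (\<Sum>is | is \<in> multi_indices (m - 1) \<and> count_list is 2 = j - 1. A (1 # is))"

definition c_coef :: "nat \<Rightarrow> (nat list \<Rightarrow> complex) \<Rightarrow> nat \<Rightarrow> complex" where
  "c_coef m A j = (\<Sum>is | is \<in> multi_indices (m - 1) \<and> count_list is 2 = j - 1. A (2 # is))"

definition d_coef :: "nat \<Rightarrow> (nat list \<Rightarrow> complex) \<Rightarrow> nat \<Rightarrow> complex" where
  "d_coef m A j = (if j = m then b_coef m A m else b_coef m A j - c_coef m A (j + 1))"

text \<open>
  Binary forms over \<open>R\<close> are elements of \<open>R[x\<^sub>1][x\<^sub>2]\<close>, i.e. of type \<open>'a poly poly\<close>, the outer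
  variable being \<open>x\<^sub>2\<close>. If \<open>F\<close> is a form of degree \<open>d\<close>, its coefficient at
  \<open>x\<^sub>1\<^sup>e x\<^sub>2\<^bsup>d-e\<^esup>\<close> is the coefficient of \<open>F(x\<^sub>1, 1) = poly F 1\<close> at \<open>x\<^sub>1\<^sup>e\<close>. The resultant
  of two forms of degrees \<open>d\<^sub>1\<close>, \<open>d\<^sub>2\<close> is the determinant of their Sylvester matrix of size
  \<open>d\<^sub>1 + d\<^sub>2\<close>. The form degrees have to be passed explicitly, since \<open>poly F 1\<close> has smaller
  degree when \<open>x\<^sub>2\<close> divides \<open>F\<close>.
\<close>

definition const_form :: "'a :: zero \<Rightarrow> 'a poly poly" where
  "const_form a = [:[:a:]:]"

definition form_var :: "nat \<Rightarrow> 'a :: comm_semiring_1 poly poly" where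
  "form_var i = (if i = 1 then [:[:0, 1:]:] else [:0, 1:])"

definition form_resultant ::
    "nat \<Rightarrow> nat \<Rightarrow> 'a :: comm_ring_1 poly poly \<Rightarrow> 'a poly poly \<Rightarrow> 'a" where
  "form_resultant d1 d2 F G = resultant_sub d1 d2 (poly F 1) (poly G 1)"

text \<open>
  The components of \<open>A x\<^bsup>m-1\<^esup> - \<lambda> (x\<^sup>T x)\<^bsup>(m-2)/2\<^esup> x\<close> (for even \<open>m\<close>) as forms of degree
  \<open>m - 1\<close> with coefficients in \<open>\<complex>[\<lambda>]\<close>; here \<open>[:0, 1:] :: complex poly\<close> is \<open>\<lambda>\<close>.
\<close>

definition eigen_form :: "nat \<Rightarrow> (nat list \<Rightarrow> complex) \<Rightarrow> nat \<Rightarrow> complex poly poly poly" where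
  "eigen_form m A i =
    hm_apply m (\<lambda>is. const_form [:A is:]) form_var i
    - const_form [:0, 1:] * sq_sum form_var ^ ((m - 2) div 2) * form_var i"

definition E_charpoly :: "nat \<Rightarrow> (nat list \<Rightarrow> complex) \<Rightarrow> complex poly" where
  "E_charpoly m A = form_resultant (m - 1) (m - 1) (eigen_form m A 1) (eigen_form m A 2)"

text \<open>
  The entries \<open>b\<close> and \<open>c\<close> with a bar; without a shift by \<open>\<lambda>\<close>, \<open>b\<^sub>j\<close> for even \<open>j\<close> and \<open>c\<^sub>j\<close>
  for odd \<open>j\<close>.
\<close>

definition b_bar :: "nat \<Rightarrow> (nat list \<Rightarrow> complex) \<Rightarrow> nat \<Rightarrow> complex poly" where
  "b_bar k A j =
    (if odd j then [:b_coef (2 * k + 2) A j, - of_nat (k choose ((j - 1) div 2)):]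
     else [:b_coef (2 * k + 2) A j:])"

definition c_bar :: "nat \<Rightarrow> (nat list \<Rightarrow> complex) \<Rightarrow> nat \<Rightarrow> complex poly" where
  "c_bar k A j =
    (if even j then [:c_coef (2 * k + 2) A j, - of_nat (k choose ((j - 2) div 2)):]
     else [:c_coef (2 * k + 2) A j:])"

text \<open>
  Matrices are indexed from 0, so row \<open>r\<close> and column \<open>s\<close> of the matrix, counted
  from 1, are at position \<open>(r - 1, s - 1)\<close>.
\<close>

definition M1_mat :: "nat \<Rightarrow> (nat list \<Rightarrow> complex) \<Rightarrow> complex poly mat" where
  "M1_mat k A = (let m = 2 * k + 2 in
    mat (2 * m - 2) (2 * m - 2) (\<lambda>(i, j). let r = i + 1; s = j + 1 in
      if r \<le> m - 1 then
        (if r \<le> s \<and> s \<le> r + m - 1 then b_bar k A (s - r + 1) else 0)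
      else if r = m then
        (if m - 1 \<le> s then c_bar k A (s - (m - 1) + 1) else 0)
      else
        (let r' = r - m in
          if s = r' then [:- c_coef m A 1:]
          else if r' < s \<and> s < r' + m then [:d_coef m A (s - r'):]
          else if s = r' + m then [:b_coef m A m:]
          else 0)))"

text \<open>
  The two properties of \<open>form_resultant\<close> below, the normalization and (over \<open>\<complex>\<close>) vanishing
  exactly when the forms have a common zero other than \<open>(0, 0)\<close>, confirm that the Sylvester
  determinant has the standard properties and sign of the classical resultant.
\<close>

definition is_form :: "nat \<Rightarrow> 'a :: zero poly poly \<Rightarrow> bool" where
  "is_form d F \<longleftrightarrow> (\<forall>i j. coeff (coeff F j) i \<noteq> 0 \<longrightarrow> i + j = d)"

definition form_eval :: "'a :: comm_semiring_1 poly poly \<Rightarrow> 'a \<Rightarrow> 'a \<Rightarrow> 'a" where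
  "form_eval F u v = poly (poly F [:v:]) u"

lemma form_resultant_normalized:
  "form_resultant d1 d2 (form_var 1 ^ d1) (form_var 2 ^ d2 :: 'a :: comm_ring_1 poly poly) = 1"
proof -
  have 1: "poly (form_var 1 ^ d1 :: 'a poly poly) 1 = monom 1 d1"
    by (simp add: form_var_def poly_power monom_altdef)
  have 2: "poly (form_var 2 ^ d2 :: 'a poly poly) 1 = 1"
    by (simp add: form_var_def poly_power)
  have "sylvester_mat_sub d1 d2 (monom 1 d1) (1 :: 'a poly) = 1\<^sub>m (d1 + d2)"
    by (rule eq_matI) (auto simp: sylvester_mat_sub_index)
  then show ?thesis
    unfolding form_resultant_def resultant_sub_def 1 2 by simp
qed

lemma sylvester_mat_sub_coeff:
  fixes p q :: "'a :: comm_ring_1 poly"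
  assumes deg: "degree p \<le> d1" "degree q \<le> d2" and ij: "i < d1 + d2" "j < d1 + d2"
  shows "sylvester_mat_sub d1 d2 p q $$ (i, j) =
    (if i < d2 then coeff (monom 1 (d2 - 1 - i) * p) (d1 + d2 - 1 - j)
     else coeff (monom 1 (d1 + d2 - 1 - i) * q) (d1 + d2 - 1 - j))"
proof (cases "i < d2")
  case True
  have "coeff p (d1 + d2 - 1 - j - (d2 - 1 - i)) = 0" if "j < i" "d2 - 1 - i \<le> d1 + d2 - 1 - j"
    using deg(1) that True by (intro coeff_eq_0) linarith
  moreover have "d1 + d2 - 1 - j - (d2 - 1 - i) = d1 + i - j" if "i \<le> j" "j - i \<le> d1"
    using that True by linarith
  ultimately show ?thesis
    using True ij by (auto simp: sylvester_mat_sub_index coeff_monom_mult)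
next
  case False
  have "coeff q (d1 + d2 - 1 - j - (d1 + d2 - 1 - i)) = 0" if "j < i - d2"
    using deg(2) that False ij by (intro coeff_eq_0) linarith
  moreover have "d1 + d2 - 1 - j - (d1 + d2 - 1 - i) = i - j" if "j \<le> i"
    using that ij by linarith
  ultimately show ?thesis
    using False ij by (auto simp: sylvester_mat_sub_index coeff_monom_mult)
qed

lemma sum_lessThan_split:
  fixes g :: "nat \<Rightarrow> 'a :: comm_monoid_add"
  shows "(\<Sum>i<m + n. g i) = (\<Sum>i<n. g i) + (\<Sum>i<m. g (n + i))"
proof -
  have "(\<Sum>i<m + n. g i) = (\<Sum>i=0..<n + m. g i)"
    by (simp add: atLeast0LessThan add.commute)
  also have "\<dots> = (\<Sum>i=0..<n. g i) + (\<Sum>i=n..<n + m. g i)"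
    by (rule sum.atLeastLessThan_concat[symmetric]) auto
  also have "(\<Sum>i=n..<n + m. g i) = (\<Sum>i<m. g (n + i))"
    using sum.shift_bounds_nat_ivl[of g 0 n m] by (simp add: atLeast0LessThan add.commute)
  finally show ?thesis by (simp add: atLeast0LessThan)
qed

lemma form_eval_eq:
  fixes F :: "'a :: comm_ring_1 poly poly"
  assumes "is_form d F"
  shows "degree (poly F 1) \<le> d"
    and "form_eval F u v = (\<Sum>i\<le>d. coeff (poly F 1) i * u ^ i * v ^ (d - i))"
proof -
  define a where "a j = coeff (coeff F j) (d - j)" for j
  have c: "coeff F j = (if j \<le> d then monom (a j) (d - j) else 0)" for j
    using assms unfolding is_form_def a_def
    by (intro poly_eqI) (auto simp: coeff_monom; metis add_diff_cancel_right' le_add2)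
  then have deg: "degree F \<le> d"
    by (intro degree_le) auto
  have F: "poly F y = (\<Sum>j\<le>d. monom (a j) (d - j) * y ^ j)" for y
  proof -
    have "poly F y = poly (\<Sum>j\<le>d. monom (coeff F j) j) y"
      using poly_as_sum_of_monoms'[OF deg] by simp
    then show ?thesis by (simp add: poly_sum poly_monom c)
  qed
  have p: "poly F 1 = (\<Sum>j\<le>d. monom (a j) (d - j))"
    by (simp add: F)
  show "degree (poly F 1) \<le> d"
    unfolding p by (intro degree_sum_le) (auto intro: order.trans[OF degree_monom_le])
  have co: "coeff (poly F 1) i = a (d - i)" if "i \<le> d" for i
  proof -
    have "coeff (poly F 1) i = (\<Sum>j\<le>d. if j = d - i then a j else 0)"
      unfolding p coeff_sum using that by (intro sum.cong) (auto simp: coeff_monom)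
    then show ?thesis by simp
  qed
  have "form_eval F u v = (\<Sum>j\<le>d. a j * u ^ (d - j) * v ^ j)"
    by (simp add: form_eval_def F poly_sum poly_monom poly_power)
  also have "\<dots> = (\<Sum>i\<le>d. a (d - i) * u ^ i * v ^ (d - i))"
    by (rule sum.reindex_bij_witness[of _ "\<lambda>i. d - i" "\<lambda>i. d - i"]) auto
  finally show "form_eval F u v = (\<Sum>i\<le>d. coeff (poly F 1) i * u ^ i * v ^ (d - i))"
    by (simp add: co)
qed

lemma common_root:
  fixes p q a b :: "complex poly"
  assumes eq: "a * p + b * q = 0" and b: "b = 0 \<or> degree b < degree p" and p: "0 < degree p"
    and ab: "a \<noteq> 0 \<or> b \<noteq> 0"
  shows "\<exists>t. poly p t = 0 \<and> poly q t = 0"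
proof -
  have "\<not> coprime p q"
  proof
    assume cop: "coprime p q"
    have "b * q = p * (- a)"
      using eq by (simp add: eq_neg_iff_add_eq_0 add.commute mult.commute)
    then have "p dvd b * q" by simp
    then have "p dvd b"
      by (simp add: coprime_dvd_mult_left_iff[OF cop])
    then have "b = 0"
      using b dvd_imp_degree_le[of p b] by linarith
    moreover have "p \<noteq> 0"
      using p by auto
    ultimately show False using eq ab by simp
  qed
  then obtain c where c: "c dvd p" "c dvd q" "\<not> is_unit c"
    unfolding coprime_def by blast
  have "c \<noteq> 0"
    using c(1) p by auto
  then have "degree c \<noteq> 0"
    using c(3) by (simp add: is_unit_iff_degree)
  then have "\<not> constant (poly c)"
    by (simp add: constant_degree)
  then obtain t where "poly c t = 0"
    using fundamental_theorem_of_algebra by blast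
  moreover from c obtain r s where "p = c * r" "q = c * s"
    unfolding dvd_def by blast
  ultimately show ?thesis
    by (intro exI[of _ t]) simp
qed

lemma form_resultant_eq_0_iff:
  fixes F G :: "complex poly poly"
  assumes F: "is_form d1 F" and G: "is_form d2 G" and d1: "0 < d1" and d2: "0 < d2"
  shows "form_resultant d1 d2 F G = 0 \<longleftrightarrow>
    (\<exists>u v. (u \<noteq> 0 \<or> v \<noteq> 0) \<and> form_eval F u v = 0 \<and> form_eval G u v = 0)"
    (is "?L \<longleftrightarrow> ?R")
proof -
  define p where "p = poly F 1"
  define q where "q = poly G 1"
  define N where "N = d1 + d2"
  define S where "S = sylvester_mat_sub d1 d2 p q"
  have S: "S \<in> carrier_mat N N"
    by (simp add: S_def N_def carrier_matI)
  have L: "?L \<longleftrightarrow> det S = 0"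
    by (simp add: form_resultant_def resultant_sub_def S_def p_def q_def)
  have degp: "degree p \<le> d1" and degq: "degree q \<le> d2"
    using form_eval_eq(1) F G by (auto simp: p_def q_def)
  have evF: "form_eval F u v = (\<Sum>i\<le>d1. coeff p i * u ^ i * v ^ (d1 - i))" for u v
    unfolding p_def by (rule form_eval_eq(2)[OF F])
  have evG: "form_eval G u v = (\<Sum>i\<le>d2. coeff q i * u ^ i * v ^ (d2 - i))" for u v
    unfolding q_def by (rule form_eval_eq(2)[OF G])
  have Sij: "S $$ (i, j) =
      (if i < d2 then coeff (monom 1 (d2 - 1 - i) * p) (N - 1 - j)
       else coeff (monom 1 (N - 1 - i) * q) (N - 1 - j))" if "i < N" "j < N" for i j
    using sylvester_mat_sub_coeff[OF degp degq] that by (simp add: S_def N_def)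
  show ?thesis
  proof
    assume ?R
    then obtain u v where uv: "u \<noteq> 0 \<or> v \<noteq> 0"
      and zero: "form_eval F u v = 0" "form_eval G u v = 0" by blast
    define w where "w = vec N (\<lambda>j. u ^ (N - 1 - j) * v ^ j)"
    have "w \<noteq> 0\<^sub>v N"
    proof
      assume w: "w = 0\<^sub>v N"
      have "w $ 0 = 0" "w $ (N - 1) = 0"
        using d1 by (simp_all add: w N_def)
      then have "u ^ (N - 1) = 0" "v ^ (N - 1) = 0"
        using d1 by (simp_all add: w_def N_def)
      then show False using uv by simp
    qed
    moreover have "S *\<^sub>v w = 0\<^sub>v N"
    proof (rule eq_vecI)
      fix i assume "i < dim_vec (0\<^sub>v N :: complex vec)"
      then have i: "i < N" by simp
      have hom: "(\<Sum>j<N. coeff (monom 1 e * r) (N - 1 - j) * (u ^ (N - 1 - j) * v ^ j)) =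
          u ^ e * v ^ (N - 1 - e - d) * (\<Sum>l\<le>d. coeff r l * u ^ l * v ^ (d - l))"
        if r: "degree r \<le> d" and e: "e + d < N" for e d and r :: "complex poly"
      proof -
        have "(\<Sum>j<N. coeff (monom 1 e * r) (N - 1 - j) * (u ^ (N - 1 - j) * v ^ j)) =
            (\<Sum>j<N. coeff (monom 1 e * r) j * (u ^ j * v ^ (N - 1 - j)))"
          by (rule sum.reindex_bij_witness[of _ "\<lambda>j. N - 1 - j" "\<lambda>j. N - 1 - j"]) auto
        also have "\<dots> = (\<Sum>j\<in>{e..e + d}. coeff (monom 1 e * r) j * (u ^ j * v ^ (N - 1 - j)))"
        proof (rule sum.mono_neutral_right)
          show "\<forall>j\<in>{..<N} - {e..e + d}. coeff (monom 1 e * r) j * (u ^ j * v ^ (N - 1 - j)) = 0"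
          proof
            fix j assume "j \<in> {..<N} - {e..e + d}"
            then have "coeff (monom 1 e * r) j = 0"
              using r by (auto simp: coeff_monom_mult intro!: coeff_eq_0)
            then show "coeff (monom 1 e * r) j * (u ^ j * v ^ (N - 1 - j)) = 0" by simp
          qed
        qed (use e in auto)
        also have "\<dots> = (\<Sum>l\<le>d. coeff r l * (u ^ (e + l) * v ^ (N - 1 - (e + l))))"
          by (rule sum.reindex_bij_witness[of _ "\<lambda>l. e + l" "\<lambda>j. j - e"])
            (auto simp: coeff_monom_mult)
        also have "\<dots> = (\<Sum>l\<le>d. u ^ e * v ^ (N - 1 - e - d) * (coeff r l * u ^ l * v ^ (d - l)))"
        proof (rule sum.cong)
          fix l assume "l \<in> {..d}"
          then have "N - 1 - (e + l) = (N - 1 - e - d) + (d - l)"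
            using e by auto
          then show "coeff r l * (u ^ (e + l) * v ^ (N - 1 - (e + l))) =
              u ^ e * v ^ (N - 1 - e - d) * (coeff r l * u ^ l * v ^ (d - l))"
            by (simp only: power_add mult_ac)
        qed simp
        finally show ?thesis by (simp add: sum_distrib_left)
      qed
      have "(S *\<^sub>v w) $ i = (\<Sum>j<N. S $$ (i, j) * (u ^ (N - 1 - j) * v ^ j))"
        using S i by (simp add: scalar_prod_def w_def atLeast0LessThan)
      also have "\<dots> = 0"
      proof (cases "i < d2")
        case True
        have "(\<Sum>j<N. S $$ (i, j) * (u ^ (N - 1 - j) * v ^ j)) =
            (\<Sum>j<N. coeff (monom 1 (d2 - 1 - i) * p) (N - 1 - j) * (u ^ (N - 1 - j) * v ^ j))"
          using True i by (intro sum.cong) (simp_all add: Sij)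
        also have "\<dots> = 0"
          by (subst hom[OF degp]) (use True d2 in \<open>auto simp: N_def zero evF[symmetric]\<close>)
        finally show ?thesis .
      next
        case False
        have "(\<Sum>j<N. S $$ (i, j) * (u ^ (N - 1 - j) * v ^ j)) =
            (\<Sum>j<N. coeff (monom 1 (N - 1 - i) * q) (N - 1 - j) * (u ^ (N - 1 - j) * v ^ j))"
          using False i by (intro sum.cong) (simp_all add: Sij)
        also have "\<dots> = 0"
          by (subst hom[OF degq]) (use False i in \<open>auto simp: N_def zero evG[symmetric]\<close>)
        finally show ?thesis .
      qed
      finally show "(S *\<^sub>v w) $ i = 0\<^sub>v N $ i" using i by simp
    qed (use S in simp)
    moreover have "w \<in> carrier_vec N" by (simp add: w_def)
    ultimately show ?L
      unfolding L det_0_iff_vec_prod_zero[OF S] by blast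
  next
    assume ?L
    then have "det (transpose_mat S) = 0"
      using L det_transpose[OF S] by simp
    then obtain y where y: "y \<in> carrier_vec N" "y \<noteq> 0\<^sub>v N" "transpose_mat S *\<^sub>v y = 0\<^sub>v N"
      using det_0_iff_vec_prod_zero[of "transpose_mat S" N] S by auto
    define a where "a = (\<Sum>i<d2. monom (y $ i) (d2 - 1 - i))"
    define b where "b = (\<Sum>i<d1. monom (y $ (d2 + i)) (d1 - 1 - i))"
    have dega: "degree a < d2" and degb: "degree b < d1"
      unfolding a_def b_def using d1 d2
      by (auto intro!: degree_sum_less intro: le_less_trans[OF degree_monom_le])
    have ab: "a \<noteq> 0 \<or> b \<noteq> 0"
    proof (rule ccontr)
      assume "\<not> (a \<noteq> 0 \<or> b \<noteq> 0)"
      then have ab0: "a = 0" "b = 0" by auto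
      have 1: "y $ i = 0" if "i < d2" for i
      proof -
        have "coeff a (d2 - 1 - i) = (\<Sum>j<d2. if j = i then y $ j else 0)"
          unfolding a_def coeff_sum using that by (intro sum.cong) (auto simp: coeff_monom)
        then show ?thesis using that ab0 by simp
      qed
      have 2: "y $ (d2 + i) = 0" if "i < d1" for i
      proof -
        have "coeff b (d1 - 1 - i) = (\<Sum>j<d1. if j = i then y $ (d2 + j) else 0)"
          unfolding b_def coeff_sum using that by (intro sum.cong) (auto simp: coeff_monom)
        then show ?thesis using that ab0 by simp
      qed
      have "y = 0\<^sub>v N"
      proof (rule eq_vecI)
        fix i assume "i < dim_vec (0\<^sub>v N :: complex vec)"
        then have "i < N" by simp
        then show "y $ i = 0\<^sub>v N $ i"
          using 1[of i] 2[of "i - d2"] by (cases "i < d2") (auto simp: N_def)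
      qed (use y in simp)
      then show False using y by simp
    qed
    have eq: "a * p + b * q = 0"
    proof (rule poly_eqI)
      fix l
      show "coeff (a * p + b * q) l = coeff 0 l"
      proof (cases "l < N")
        case False
        have "degree (a * p) < N" "degree (b * q) < N"
          using degree_mult_le[of a p] degree_mult_le[of b q] dega degb degp degq
          by (auto simp: N_def)
        then show ?thesis using False by (simp add: coeff_eq_0)
      next
        case True
        define j where "j = N - 1 - l"
        have j: "j < N" "l = N - 1 - j" using True by (auto simp: j_def)
        have sm: "monom c n * r = smult c (monom 1 n * r)" for c n and r :: "complex poly"
          by (metis mult.right_neutral mult_smult_left smult_monom)
        have "0 = (transpose_mat S *\<^sub>v y) $ j"
          unfolding y(3) using j by simp
        also have "\<dots> = (\<Sum>i<N. S $$ (i, j) * y $ i)"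
          using S y(1) j by (simp add: scalar_prod_def atLeast0LessThan)
        also have "\<dots> = (\<Sum>i<d2. S $$ (i, j) * y $ i) + (\<Sum>i<d1. S $$ (d2 + i, j) * y $ (d2 + i))"
          unfolding N_def by (rule sum_lessThan_split)
        also have "(\<Sum>i<d2. S $$ (i, j) * y $ i) = coeff (a * p) l"
          unfolding a_def sum_distrib_right coeff_sum
          by (intro sum.cong refl, subst sm) (use j Sij in \<open>simp add: N_def\<close>)
        also have "(\<Sum>i<d1. S $$ (d2 + i, j) * y $ (d2 + i)) = coeff (b * q) l"
        proof -
          have "S $$ (d2 + i, j) * y $ (d2 + i) = coeff (monom (y $ (d2 + i)) (d1 - 1 - i) * q) l"
            if "i < d1" for i
          proof -
            have "N - 1 - (d2 + i) = d1 - 1 - i" by (simp add: N_def)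
            then show ?thesis
              using Sij[of "d2 + i" j] that j by (subst sm) (simp add: N_def)
          qed
          then show ?thesis
            unfolding b_def sum_distrib_right coeff_sum by (intro sum.cong) auto
        qed
        finally show ?thesis by simp
      qed
    qed
    have affine: ?R if "poly p t = 0" "poly q t = 0" for t
    proof -
      have "form_eval F t 1 = poly p t" "form_eval G t 1 = poly q t"
        by (simp_all add: form_eval_def p_def q_def one_pCons)
      then show ?thesis using that by (intro exI[of _ t] exI[of _ 1]) simp
    qed
    consider "degree p = d1" | "degree q = d2" | "coeff p d1 = 0" "coeff q d2 = 0"
      using degp degq by (meson coeff_eq_0 le_neq_implies_less)
    then show ?R
    proof cases
      case 1
      then show ?thesis
        using common_root[OF eq _ _ ab] degb d1 affine by auto
    next
      case 2
      have "b * q + a * p = 0" using eq by (simp add: add.commute)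
      from common_root[OF this _ _ ab[THEN disj_commute[THEN iffD1]]]
      show ?thesis using 2 dega d2 affine by auto
    next
      case 3
      have "form_eval F 1 0 = (\<Sum>i\<le>d1. if i = d1 then coeff p i else 0)"
        unfolding evF by (intro sum.cong) auto
      moreover have "form_eval G 1 0 = (\<Sum>i\<le>d2. if i = d2 then coeff q i else 0)"
        unfolding evG by (intro sum.cong) auto
      ultimately show ?thesis
        using 3 by (intro exI[of _ 1] exI[of _ 0]) simp
    qed
  qed
qed

end

theory Submission
  imports Defs
begin

text \<open>
  Let \<open>F, G\<close> be the two components of \<open>A x\<^bsup>m-1\<^esup> - \<lambda> (x\<^sup>T x)\<^sup>k x\<close>. The parameter \<open>\<lambda>\<close> cancels in
  \<open>H = x\<^sub>2 F - x\<^sub>1 G\<close>, whose coefficients are \<open>-c\<^sub>1, d\<^sub>1, \<dots>, d\<^sub>m\<^sub>-\<^sub>1, b\<^sub>m\<close>. The rows of \<open>M\<^sub>1\<close> are the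
  monomial multiples of \<open>F\<close>, one multiple of \<open>G\<close>, and the monomial multiples of \<open>H\<close>, so \<open>M\<^sub>1\<close> is
  the product of a block triangular matrix of determinant 1 with the Sylvester matrix of \<open>F, G\<close>.
\<close>

text \<open>Acts on the Sylvester rows x1^(n-1-j) x2^j G: row 0 selects x2^(n-1) G, and row i > 0
  supplies the G-part of x1^(n-1-i) x2^(i-1) H.\<close>

definition row_ops_block :: "nat \<Rightarrow> 'a :: comm_ring_1 mat" where
  "row_ops_block n = mat n n (\<lambda>(i, j).
    if i = 0 then (if j = n - 1 then 1 else 0) else if i = j + 1 then - 1 else 0)"

text \<open>The lower left block adds the F-part of each multiple of H; its row 0 is zero because
  row n of the product is a pure multiple of G.\<close>

definition row_ops :: "nat \<Rightarrow> 'a :: comm_ring_1 mat" where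
  "row_ops n = four_block_mat (1\<^sub>m n) (0\<^sub>m n n)
    (mat n n (\<lambda>(i, j). if i = j \<and> 0 < i then 1 else 0)) (row_ops_block n)"

lemma row_ops_carrier: "row_ops n \<in> carrier_mat (n + n) (n + n)"
  by (simp add: row_ops_def row_ops_block_def)

lemma dim_row_ops [simp]: "dim_row (row_ops n) = n + n" "dim_col (row_ops n) = n + n"
  using row_ops_carrier[of n] by blast+

text \<open>Expansion along the last column leaves minus the identity of size n - 1, whose
  determinant cancels the cofactor sign.\<close>

lemma det_row_ops_block:
  assumes "0 < n"
  shows "det (row_ops_block n :: 'a :: comm_ring_1 mat) = 1"
proof -
  let ?V = "row_ops_block n :: 'a mat"
  have V: "?V \<in> carrier_mat n n" by (simp add: row_ops_block_def)
  have minor: "mat_delete ?V 0 (n - 1) = (- 1) \<cdot>\<^sub>m 1\<^sub>m (n - 1)"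
    by (rule eq_matI) (auto simp: mat_delete_def row_ops_block_def)
  have "det ?V = (\<Sum>i<n. ?V $$ (i, n - 1) * cofactor ?V i (n - 1))"
    by (rule laplace_expansion_column[OF V]) (use assms in simp)
  also have "\<dots> = (\<Sum>i<n. if i = 0 then cofactor ?V 0 (n - 1) else 0)"
    by (rule sum.cong) (auto simp: row_ops_block_def)
  also have "\<dots> = cofactor ?V 0 (n - 1)" using assms by simp
  also have "\<dots> = 1"
    unfolding cofactor_def minor by (simp flip: power_mult_distrib)
  finally show ?thesis .
qed

lemma det_row_ops:
  assumes "0 < n"
  shows "det (row_ops n :: 'a :: idom mat) = 1"
  unfolding row_ops_def
  by (subst det_four_block_mat_upper_right_zero[where n = n and m = n])
    (auto simp: det_row_ops_block[OF assms], auto simp: row_ops_block_def)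

lemma row_ops_mult_index:
  fixes S :: "'a :: comm_ring_1 mat"
  assumes S: "S \<in> carrier_mat (n + n) (n + n)" and i: "i < n + n" and j: "j < n + n"
  shows "(row_ops n * S) $$ (i, j) =
    (if i < n then S $$ (i, j)
     else if i = n then S $$ (n + n - 1, j)
     else S $$ (i - n, j) - S $$ (i - 1, j))"
proof -
  have sum: "(row_ops n * S) $$ (i, j) = (\<Sum>l<n + n. row_ops n $$ (i, l) * S $$ (l, j))"
    using S i j
    by (simp add: row_ops_def row_ops_block_def scalar_prod_def atLeast0LessThan)
  consider "i < n" | "i = n" | "n < i" by linarith
  then show ?thesis
  proof cases
    case 1
    have "row_ops n $$ (i, l) * S $$ (l, j) = (if l = i then S $$ (l, j) else 0)"
      if "l < n + n" for l
      using 1 that by (simp add: row_ops_def row_ops_block_def)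
    then show ?thesis unfolding sum using 1 by simp
  next
    case 2
    have "row_ops n $$ (i, l) * S $$ (l, j) = (if l = n + n - 1 then S $$ (l, j) else 0)"
      if "l < n + n" for l
      using 2 i that by (simp add: row_ops_def row_ops_block_def) linarith
    then show ?thesis unfolding sum using 2 i by simp
  next
    case 3
    have "row_ops n $$ (i, l) * S $$ (l, j) =
        (if l = i - n then S $$ (l, j) else 0) - (if l = i - 1 then S $$ (l, j) else 0)"
      if "l < n + n" for l
    \<comment> \<open>The two nonzero entries of row i lie in different blocks: i - n < n, whereas i
      - 1 is at least n.\<close>
    proof (cases "l < n")
      case True
      have "i - n = l \<longleftrightarrow> l = i - n" "l \<noteq> i - 1" using 3 True by auto
      then show ?thesis using 3 i True by (simp add: row_ops_def row_ops_block_def)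
    next
      case False
      have "i - n = Suc (l - n) \<longleftrightarrow> l = i - 1" "l \<noteq> i - n" using 3 i False by auto
      then show ?thesis using 3 i that False by (simp add: row_ops_def row_ops_block_def)
    qed
    then show ?thesis unfolding sum using 3 i by (simp add: sum_subtractf less_imp_diff_less)
  qed
qed

text \<open>At x2 = 1 the monomial of an index list becomes x1 to the number of its entries 1, so
  lists with l entries 2 contribute in degree m - 1 - l.\<close>

lemma coeff_poly_hm_apply:
  fixes A :: "nat list \<Rightarrow> complex"
  assumes "1 \<le> m" "l \<le> m - 1"
  shows "coeff (poly (hm_apply m (\<lambda>is. const_form [:A is:]) form_var i) 1) (m - 1 - l) =
    [:\<Sum>is | is \<in> multi_indices (m - 1) \<and> count_list is 2 = l. A (i # is):]"
proof -
  have fin: "finite (multi_indices (m - 1))"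
    unfolding multi_indices_def by (rule finite_lists_length_eq) simp
  have mono: "poly (prod_list (map form_var is)) 1 = (monom 1 (length is - count_list is 2) :: complex poly poly)"
    if "set is \<subseteq> {1, 2}" for "is"
    using that
  proof (induction "is")
    case (Cons a xs)
    then show ?case
      using count_le_length[of xs 2]
      by (auto simp: form_var_def monom_altdef Suc_diff_le)
  qed simp
  have "coeff (poly (hm_apply m (\<lambda>is. const_form [:A is:]) form_var i) 1) (m - 1 - l) =
      (\<Sum>is\<in>multi_indices (m - 1). if count_list is 2 = l then [:A (i # is):] else 0)"
    unfolding hm_apply_def poly_sum coeff_sum poly_mult
  proof (rule sum.cong)
    fix "is" assume "is \<in> multi_indices (m - 1)"
    then have s: "set is \<subseteq> {1, 2}" and len: "length is = m - 1"
      by (auto simp: multi_indices_def)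
    \<comment> \<open>Truncated subtraction is injective here, as both subtrahends are at most m -
      1.\<close>
    have "m - 1 - count_list is 2 = m - 1 - l \<longleftrightarrow> count_list is 2 = l"
      using assms count_le_length[of "is" 2] len by auto
    then show "coeff (poly (const_form [:A (i # is):]) 1 * poly (prod_list (map form_var is)) 1)
        (m - 1 - l) = (if count_list is 2 = l then [:A (i # is):] else 0)"
      unfolding mono[OF s] by (simp add: len const_form_def coeff_monom)
  qed simp
  also have "\<dots> = (\<Sum>is | is \<in> multi_indices (m - 1) \<and> count_list is 2 = l. [:A (i # is):])"
    by (subst sum.inter_filter[OF fin, symmetric]) simp
  also have "\<dots> = [:\<Sum>is | is \<in> multi_indices (m - 1) \<and> count_list is 2 = l. A (i # is):]"
    by (induction rule: infinite_finite_induct) simp_all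
  finally show ?thesis .
qed

text \<open>The polynomial is the k-th power of x^T x at x2 = 1.\<close>

lemma coeff_sq_plus_one_power:
  "coeff (([:0, 1:] ^ 2 + 1) ^ k :: 'a :: comm_ring_1 poly) e =
    (if even e then of_nat (k choose (e div 2)) else 0)"
proof -
  have "([:0, 1:] ^ 2 + 1) ^ k = (\<Sum>i\<le>k. of_nat (k choose i) * monom (1 :: 'a) (2 * i))"
    by (simp add: binomial_ring monom_altdef power_mult)
  then have "coeff (([:0, 1:] ^ 2 + 1) ^ k :: 'a poly) e =
      (\<Sum>i\<le>k. coeff (of_nat (k choose i) * monom 1 (2 * i)) e)"
    by (simp only: coeff_sum)
  also have "\<dots> = (\<Sum>i\<le>k. if i = e div 2 then (if even e then of_nat (k choose i) else 0) else 0)"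
    by (rule sum.cong) (auto simp: of_nat_poly coeff_monom)
  \<comment> \<open>If \<open>e div 2\<close> exceeds k, the index is outside the sum, and the
    binomial is 0 too.\<close>
  finally show ?thesis by (simp add: binomial_eq_0)
qed

lemma coeff_eigen_form_1:
  assumes "l \<le> 2 * k + 1"
  shows "coeff (poly (eigen_form (2 * k + 2) A 1) 1) (2 * k + 1 - l) = b_bar k A (l + 1)"
proof -
  have "coeff ([:0, 1:] * ([:0, 1:] ^ 2 + 1) ^ k :: complex poly poly) (2 * k + 1 - l) =
      (if even l then of_nat (k choose (l div 2)) else 0)"
  \<comment> \<open>This l gives the constant coefficient, which vanishes because of the factor x1.
    Otherwise that factor lowers the exponent by one.\<close>
  proof (cases "l = 2 * k + 1")
    case False
    then have e: "2 * k + 1 - l = Suc (2 * k - l)" using assms by simp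
    \<comment> \<open>\<open>b_bar\<close> counts from the leading coefficient down, hence the
      symmetry of the binomials.\<close>
    have "k choose ((2 * k - l) div 2) = k choose (l div 2)" if "even l"
    proof -
      have "(2 * k - l) div 2 = k - l div 2" "l div 2 \<le> k"
        using that False assms by presburger+
      then show ?thesis by (simp flip: binomial_symmetric)
    qed
    then show ?thesis
      unfolding e using assms False
      by (auto simp: coeff_sq_plus_one_power)
  qed simp
  moreover have "poly (eigen_form (2 * k + 2) A 1) 1 =
      poly (hm_apply (2 * k + 2) (\<lambda>is. const_form [:A is:]) form_var 1) 1
      - smult [:0, 1:] ([:0, 1:] * ([:0, 1:] ^ 2 + 1) ^ k)"
    by (simp add: eigen_form_def sq_sum_def form_var_def const_form_def poly_power)
  ultimately show ?thesis
    using coeff_poly_hm_apply[of "2 * k + 2" l A 1] assms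
    by (simp add: b_bar_def b_coef_def of_nat_poly del: mult_pCons_left)
qed

text \<open>The factor x2 becomes 1, so exponents are not shifted and \<lambda> occurs for odd l
  instead of even l.\<close>

lemma coeff_eigen_form_2:
  assumes "l \<le> 2 * k + 1"
  shows "coeff (poly (eigen_form (2 * k + 2) A 2) 1) (2 * k + 1 - l) = c_bar k A (l + 1)"
proof -
  have "coeff (([:0, 1:] ^ 2 + 1) ^ k :: complex poly poly) (2 * k + 1 - l) =
      (if odd l then of_nat (k choose ((l - 1) div 2)) else 0)"
  proof -
    have "k choose ((2 * k + 1 - l) div 2) = k choose ((l - 1) div 2)" if "odd l"
    proof -
      have "(2 * k + 1 - l) div 2 = k - (l - 1) div 2" "(l - 1) div 2 \<le> k"
        using that assms by presburger+
      then show ?thesis by (simp flip: binomial_symmetric)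
    qed
    then show ?thesis
      using assms by (auto simp: coeff_sq_plus_one_power)
  qed
  moreover have "poly (eigen_form (2 * k + 2) A 2) 1 =
      poly (hm_apply (2 * k + 2) (\<lambda>is. const_form [:A is:]) form_var 2) 1
      - smult [:0, 1:] (([:0, 1:] ^ 2 + 1) ^ k)"
    by (simp add: eigen_form_def sq_sum_def form_var_def const_form_def poly_power)
  ultimately show ?thesis
    using coeff_poly_hm_apply[of "2 * k + 2" l A 2] assms
    by (simp add: c_bar_def c_coef_def of_nat_poly)
qed

text \<open>For odd j both terms carry \<lambda> with the same binomial, for even j neither does;
  this is the cancellation of \<lambda> in H.\<close>

lemma b_bar_minus_c_bar:
  assumes "0 < j" "j < 2 * k + 2"
  shows "b_bar k A j - c_bar k A (j + 1) = [:d_coef (2 * k + 2) A j:]"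
  using assms by (auto simp: b_bar_def c_bar_def d_coef_def)

lemma M1_mat_eq_row_ops_mult:
  fixes k :: nat and A :: "nat list \<Rightarrow> complex"
  defines "n \<equiv> 2 * k + 1"
  shows "M1_mat k A = row_ops n * sylvester_mat_sub n n
    (poly (eigen_form (2 * k + 2) A 1) 1) (poly (eigen_form (2 * k + 2) A 2) 1)"
    (is "_ = _ * ?S")
proof (rule eq_matI)
  have S: "?S \<in> carrier_mat (n + n) (n + n)" by (simp add: carrier_matI)
  have M: "M1_mat k A \<in> carrier_mat (n + n) (n + n)"
    by (simp add: M1_mat_def Let_def n_def)
  show "dim_row (M1_mat k A) = dim_row (row_ops n * ?S)"
    and "dim_col (M1_mat k A) = dim_col (row_ops n * ?S)"
    using carrier_matD[OF S] carrier_matD[OF M] by auto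
  fix i j
  assume "i < dim_row (row_ops n * ?S)" "j < dim_col (row_ops n * ?S)"
  then have i: "i < n + n" and j: "j < n + n" using carrier_matD[OF S] by auto
  \<comment> \<open>Row r is x1^(n-1-r) x2^r F, and column j belongs to the monomial x1^(2n-1-j)
    x2^j.\<close>
  have SF: "?S $$ (r, j) = (if r \<le> j \<and> j \<le> r + n then b_bar k A (j - r + 1) else 0)"
    if "r < n" for r
    using that j coeff_eigen_form_1[of "j - r" k A]
    by (auto simp: sylvester_mat_sub_index n_def)
  have SG: "?S $$ (n + r, j) = (if r \<le> j \<and> j \<le> r + n then c_bar k A (j - r + 1) else 0)"
    if "r < n" for r
    using that j coeff_eigen_form_2[of "j - r" k A]
    by (auto simp: sylvester_mat_sub_index n_def)
  show "M1_mat k A $$ (i, j) = (row_ops n * ?S) $$ (i, j)"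
  proof (cases "i \<le> n")
    case True
    then show ?thesis
      unfolding row_ops_mult_index[OF S i j]
      using i j SF[of i] SG[of "n - 1"] by (auto simp: M1_mat_def Let_def n_def)
  next
    case False
    define r where "r = i - n"
    have r: "i = n + r" "0 < r" "r < n" using False i by (auto simp: r_def)
    \<comment> \<open>This row is x1^(n-1-r) x2^(r-1) H: the F-part starts in column r, the G-part
      in column r - 1.\<close>
    have "(row_ops n * ?S) $$ (i, j) =
        (if r \<le> j \<and> j \<le> r + n then b_bar k A (j - r + 1) else 0)
        - (if r - 1 \<le> j \<and> j \<le> r - 1 + n then c_bar k A (j - (r - 1) + 1) else 0)"
      unfolding row_ops_mult_index[OF S i j] using r SF[of r] SG[of "r - 1"] by simp
    \<comment> \<open>The end entries can be written with bars, since 1 is odd and m is even and so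
      neither contains \<lambda>.\<close>
    moreover have "M1_mat k A $$ (i, j) =
        (if j + 1 = r then - c_bar k A 1
         else if r \<le> j \<and> j < r + n then [:d_coef (2 * k + 2) A (j - r + 1):]
         else if j = r + n then b_bar k A (2 * k + 2) else 0)"
      using r i j by (auto simp: M1_mat_def Let_def n_def b_bar_def c_bar_def Suc_diff_le)
    moreover have "b_bar k A (j - r + 1) - c_bar k A (j - r + 2) =
        [:d_coef (2 * k + 2) A (j - r + 1):]" if "j < r + n"
      using b_bar_minus_c_bar[of "j - r + 1" k A] that by (simp add: n_def)
    moreover have "j - (r - 1) + 1 = j - r + 2" if "r \<le> j" using that r by simp
    ultimately show ?thesis
      using r by (auto simp: n_def)
  qed
qed

theorem theorem3:
  fixes k m :: nat and A :: "nat list \<Rightarrow> complex"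
  assumes "m = 2 * k + 2"
    and "regular m A"
  shows "E_charpoly m A = det (M1_mat k A)"
proof -
  define n where "n = 2 * k + 1"
  define S where "S = sylvester_mat_sub n n
    (poly (eigen_form m A 1) 1) (poly (eigen_form m A 2) 1)"
  have S: "S \<in> carrier_mat (n + n) (n + n)"
    by (simp add: S_def carrier_matI)
  have "0 < n" by (simp add: n_def)
  have "det (M1_mat k A) = det (row_ops n * S)"
    unfolding M1_mat_eq_row_ops_mult S_def n_def assms(1) ..
  also have "\<dots> = det S"
    by (simp add: det_mult[OF row_ops_carrier S] det_row_ops \<open>0 < n\<close>)
  also have "\<dots> = E_charpoly m A"
    by (simp add: E_charpoly_def form_resultant_def resultant_sub_def S_def n_def assms(1))
  finally show ?thesis ..
qed

end
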